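(* Let $S$ and $T$ be pomonoids, let $B_S$ be a right $S$-poset, let ${}_TA_S$ be a $T$-$S$-biposet, and suppose that $A\times B$ is a cyclic projective right $S$-poset. If $f:A_S\to B_S$ is an Emb-injective object in the slice category $\mathbf{Pos}\text{-}S/B_S$ and the pomonoid homomorphism $\lambda:T\to\mathrm{End}(A_S)$, $t\mapsto\lambda_t$ with $\lambda_t(a)=ta$, is an isomorphism, then ${}_TA$ is a generator in $T\text{-}\mathbf{Pos}$.
   Context: A pomonoid is a monoid $S$ with a partial order $\leq$ such that $s\leq t$ and $s'\leq t'$ imply $ss'\leq tt'$. A (right) $S$-poset is a poset $A$ with a right monoid action $A\times S\to A$ that is order-preserving for the componentwise order on $A\times S$; left $T$-posets are defined analogously. $\mathbf{Pos}\text{-}S$ and $T\text{-}\mathbf{Pos}$ are the categories of right $S$-posets and left $T$-posets with monotone action-preserving maps. A $T$-$S$-biposet ${}_TA_S$ is a poset that is both a left $T$-poset and a right $S$-poset with $(ta)s=t(as)$ for all $t\in T$, $a\in A$, $s\in S$. $A\times B$ is the product of right $S$-posets, with componentwise order and action. $\mathrm{End}(A_S)$ is the pomonoid of all $S$-poset maps $A_S\to A_S$ under composition with pointwise order; an isomorphism of pomonoids is a monoid isomorphism that is also an order isomorphism. An object $G$ is a generator if for any two distinct morphisms $\alpha,\beta:X\to Y$ there is a morphism $g:G\to X$ with $\alpha g\neq\beta g$. Projective means projective with respect to epimorphisms, which are exactly the surjective morphisms; a right $S$-poset $C$ is cyclic if $C=cS$ for some $c\in C$; cyclic projective means cyclic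 and projective. Objects of $\mathbf{Pos}\text{-}S/B_S$ are $S$-poset maps with codomain $B_S$, morphisms are commutative triangles over $B_S$. Order-embeddings are $S$-poset maps $h$ with $h(x)\leq h(y)\iff x\leq y$. An object $f:A_S\to B_S$ is Emb-injective in $\mathbf{Pos}\text{-}S/B_S$ if for every order-embedding $h:U\to V$ of $S$-posets and $S$-poset maps $u:U\to A_S$, $v:V\to B_S$ with $fu=vh$, there is an $S$-poset map $s:V\to A_S$ with $sh=u$ and $fs=v$. *)

theory Defs
  imports "HOL-Algebra.Group" "HOL-Library.Equipollence"
begin

text \<open>
  Carriers are explicit sets and an order on a carrier \<open>C\<close> is a relation
  \<open>r \<subseteq> C \<times> C\<close>, as in the library's \<^const>\<open>partial_order_on\<close>.
  Carriers of posets with action may be empty.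
\<close>

section \<open>Pomonoids\<close>

record 'a pomonoid = "'a monoid" +
  mle :: "('a \<times> 'a) set"

locale pomonoid = monoid S for S (structure) +
  assumes mle_partial_order: "partial_order_on (carrier S) (mle S)"
    and mult_mono:
      "\<lbrakk> (s, t) \<in> mle S; (s', t') \<in> mle S \<rbrakk> \<Longrightarrow> (s \<otimes> s', t \<otimes> t') \<in> mle S"

definition pomonoid_iso ::
  "('a, 'm) pomonoid_scheme \<Rightarrow> ('b, 'n) pomonoid_scheme \<Rightarrow> ('a \<Rightarrow> 'b) set" where
  "pomonoid_iso S T =
     {\<phi> \<in> iso S T. \<phi> \<one>\<^bsub>S\<^esub> = \<one>\<^bsub>T\<^esub> \<and>
        (\<forall>s \<in> carrier S. \<forall>s' \<in> carrier S. (s, s') \<in> mle S \<longleftrightarrow> (\<phi> s, \<phi> s') \<in> mle T)}"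


section \<open>Right and left posets over a pomonoid, biposets\<close>

record 'a poset = "'a partial_object" +
  ple :: "('a \<times> 'a) set"

record ('a, 's) rsposet = "'a poset" +
  ract :: "'a \<Rightarrow> 's \<Rightarrow> 'a"

record ('a, 't) ltposet = "'a poset" +
  lact :: "'t \<Rightarrow> 'a \<Rightarrow> 'a"

record ('a, 's, 't) biposet = "'a poset" +
  bract :: "'a \<Rightarrow> 's \<Rightarrow> 'a"
  blact :: "'t \<Rightarrow> 'a \<Rightarrow> 'a"

locale rsposet = pomonoid S
  for S :: "('s, 'm) pomonoid_scheme" (structure) and A :: "('a, 's) rsposet" +
  assumes ple_partial_order: "partial_order_on (carrier A) (ple A)"
    and ract_closed: "\<lbrakk> a \<in> carrier A; s \<in> carrier S \<rbrakk> \<Longrightarrow> ract A a s \<in> carrier A"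
    and ract_one: "a \<in> carrier A \<Longrightarrow> ract A a \<one> = a"
    and ract_mult: "\<lbrakk> a \<in> carrier A; s \<in> carrier S; t \<in> carrier S \<rbrakk>
      \<Longrightarrow> ract A a (s \<otimes> t) = ract A (ract A a s) t"
    and ract_mono: "\<lbrakk> (a, b) \<in> ple A; (s, t) \<in> mle S \<rbrakk>
      \<Longrightarrow> (ract A a s, ract A b t) \<in> ple A"

locale ltposet = pomonoid T
  for T :: "('t, 'm) pomonoid_scheme" (structure) and A :: "('a, 't) ltposet" +
  assumes ple_partial_order: "partial_order_on (carrier A) (ple A)"
    and lact_closed: "\<lbrakk> t \<in> carrier T; a \<in> carrier A \<rbrakk> \<Longrightarrow> lact A t a \<in> carrier A"
    and lact_one: "a \<in> carrier A \<Longrightarrow> lact A \<one> a = a"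
    and lact_mult: "\<lbrakk> s \<in> carrier T; t \<in> carrier T; a \<in> carrier A \<rbrakk>
      \<Longrightarrow> lact A (s \<otimes> t) a = lact A s (lact A t a)"
    and lact_mono: "\<lbrakk> (s, t) \<in> mle T; (a, b) \<in> ple A \<rbrakk>
      \<Longrightarrow> (lact A s a, lact A t b) \<in> ple A"

definition right_part :: "('a, 's, 't) biposet \<Rightarrow> ('a, 's) rsposet" where
  "right_part A = \<lparr>carrier = carrier A, ple = ple A, ract = bract A\<rparr>"

definition left_part :: "('a, 's, 't) biposet \<Rightarrow> ('a, 't) ltposet" where
  "left_part A = \<lparr>carrier = carrier A, ple = ple A, lact = blact A\<rparr>"

locale biposet =
  right: rsposet S "right_part A" + left: ltposet T "left_part A"
  for T :: "('t, 'n) pomonoid_scheme" and S :: "('s, 'm) pomonoid_scheme"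
    and A :: "('a, 's, 't) biposet" +
  assumes actions_commute: "\<lbrakk> t \<in> carrier T; a \<in> carrier A; s \<in> carrier S \<rbrakk>
    \<Longrightarrow> bract A (blact A t a) s = blact A t (bract A a s)"


section \<open>Morphisms\<close>

text \<open>
  Morphisms are extensional functions (value \<^const>\<open>undefined\<close> off the carrier), so that
  equality of morphisms is equality in HOL; they are composed by \<^const>\<open>compose\<close>.
\<close>

definition rhom ::
  "('s, 'm) pomonoid_scheme \<Rightarrow> ('a, 's) rsposet \<Rightarrow> ('b, 's) rsposet \<Rightarrow> ('a \<Rightarrow> 'b) set" where
  "rhom S A B =
     {f \<in> carrier A \<rightarrow>\<^sub>E carrier B.
        (\<forall>x y. (x, y) \<in> ple A \<longrightarrow> (f x, f y) \<in> ple B) \<and>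
        (\<forall>x \<in> carrier A. \<forall>s \<in> carrier S. f (ract A x s) = ract B (f x) s)}"

definition lhom ::
  "('t, 'm) pomonoid_scheme \<Rightarrow> ('a, 't) ltposet \<Rightarrow> ('b, 't) ltposet \<Rightarrow> ('a \<Rightarrow> 'b) set" where
  "lhom T A B =
     {f \<in> carrier A \<rightarrow>\<^sub>E carrier B.
        (\<forall>x y. (x, y) \<in> ple A \<longrightarrow> (f x, f y) \<in> ple B) \<and>
        (\<forall>x \<in> carrier A. \<forall>t \<in> carrier T. f (lact A t x) = lact B t (f x))}"

definition order_embedding ::
  "('s, 'm) pomonoid_scheme \<Rightarrow> ('a, 's) rsposet \<Rightarrow> ('b, 's) rsposet \<Rightarrow> ('a \<Rightarrow> 'b) \<Rightarrow> bool" where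
  "order_embedding S A B h \<longleftrightarrow>
     h \<in> rhom S A B \<and>
     (\<forall>x \<in> carrier A. \<forall>y \<in> carrier A. (h x, h y) \<in> ple B \<longleftrightarrow> (x, y) \<in> ple A)"

definition End_pomonoid ::
  "('s, 'm) pomonoid_scheme \<Rightarrow> ('a, 's) rsposet \<Rightarrow> ('a \<Rightarrow> 'a) pomonoid" where
  "End_pomonoid S A =
     \<lparr>carrier = rhom S A A,
      mult = compose (carrier A),
      one = (\<lambda>a \<in> carrier A. a),
      mle = {(f, g). f \<in> rhom S A A \<and> g \<in> rhom S A A \<and>
                     (\<forall>a \<in> carrier A. (f a, g a) \<in> ple A)}\<rparr>"

definition prod_rsposet ::
  "('a, 's) rsposet \<Rightarrow> ('b, 's) rsposet \<Rightarrow> ('a \<times> 'b, 's) rsposet" where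
  "prod_rsposet A B =
     \<lparr>carrier = carrier A \<times> carrier B,
      ple = {((a, b), (a', b')). (a, a') \<in> ple A \<and> (b, b') \<in> ple B},
      ract = (\<lambda>(a, b) s. (ract A a s, ract B b s))\<rparr>"


section \<open>Cyclic, projective and Emb-injective objects, generators\<close>

text \<open>
  HOL cannot quantify over types inside a formula. Notions that quantify over all objects of a
  category therefore take a type argument, the universe: the test objects range over all
  objects whose carrier is a subset of that type.
\<close>

definition cyclic :: "('s, 'm) pomonoid_scheme \<Rightarrow> ('a, 's) rsposet \<Rightarrow> bool" where
  "cyclic S C \<longleftrightarrow>
     rsposet S C \<and> (\<exists>c \<in> carrier C. carrier C = {ract C c s |s. s \<in> carrier S})"

text \<open>
  Lifting is required along epimorphisms, which for right \<open>S\<close>-posets are exactly the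
  surjective morphisms; surjectivity, unlike right cancellability, does not depend on the universe.
\<close>

definition projective ::
  "'u itself \<Rightarrow> ('s, 'm) pomonoid_scheme \<Rightarrow> ('a, 's) rsposet \<Rightarrow> bool" where
  "projective (universe :: 'u itself) S P \<longleftrightarrow>
     rsposet S P \<and>
     (\<forall>(X :: ('u, 's) rsposet) (Y :: ('u, 's) rsposet) q g.
        rsposet S X \<and> rsposet S Y \<and>
        q \<in> rhom S X Y \<and> q ` carrier X = carrier Y \<and> g \<in> rhom S P Y \<longrightarrow>
        (\<exists>g' \<in> rhom S P X. compose (carrier P) q g' = g))"

definition emb_injective ::
  "'u itself \<Rightarrow> ('s, 'm) pomonoid_scheme \<Rightarrow> ('a, 's) rsposet \<Rightarrow> ('b, 's) rsposet
     \<Rightarrow> ('a \<Rightarrow> 'b) \<Rightarrow> bool" where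
  "emb_injective (universe :: 'u itself) S A B f \<longleftrightarrow>
     rsposet S A \<and> rsposet S B \<and> f \<in> rhom S A B \<and>
     (\<forall>(U :: ('u, 's) rsposet) (V :: ('u, 's) rsposet) h u v.
        rsposet S U \<and> rsposet S V \<and> order_embedding S U V h \<and>
        u \<in> rhom S U A \<and> v \<in> rhom S V B \<and>
        compose (carrier U) f u = compose (carrier U) v h \<longrightarrow>
        (\<exists>s \<in> rhom S V A. compose (carrier U) s h = u \<and> compose (carrier V) f s = v))"

definition generator ::
  "'u itself \<Rightarrow> ('t, 'm) pomonoid_scheme \<Rightarrow> ('a, 't) ltposet \<Rightarrow> bool" where
  "generator (universe :: 'u itself) T G \<longleftrightarrow>
     ltposet T G \<and>
     (\<forall>(X :: ('u, 't) ltposet) (Y :: ('u, 't) ltposet) \<alpha> \<beta>.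
        ltposet T X \<and> ltposet T Y \<and> \<alpha> \<in> lhom T X Y \<and> \<beta> \<in> lhom T X Y \<and> \<alpha> \<noteq> \<beta> \<longrightarrow>
        (\<exists>g \<in> lhom T G X. compose (carrier G) \<alpha> g \<noteq> compose (carrier G) \<beta> g))"

end

theory Submission
  imports Defs
begin

text \<open>
  Let \<open>c = (a\<^sub>0, b\<^sub>0)\<close> generate \<open>A \<times> B\<close>. Projectivity splits the surjection \<open>S \<rightarrow> A \<times> B\<close>,
  \<open>s \<mapsto> cs\<close>, by an \<open>S\<close>-poset map \<open>g\<close>. Then \<open>(a, x) \<mapsto> a g(x, f x)\<close> is monotone, commutes with \<open>T\<close>
  in \<open>a\<close> and with \<open>S\<close> in \<open>x\<close>, and equals \<open>x\<close> at \<open>a = a\<^sub>0\<close>. Currying, it is a left \<open>T\<close>-poset map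
  from \<open>A\<close> to \<open>End(A\<^sub>S) \<cong> T\<close> whose image contains the identity, and such a map makes \<open>A\<close> a generator.
\<close>

lemma partial_order_on_carrier:
  assumes "partial_order_on C r" and "(x, y) \<in> r"
  shows "x \<in> C" "y \<in> C"
  using assms unfolding partial_order_on_def preorder_on_def refl_on_def by auto

lemma partial_order_on_refl:
  assumes "partial_order_on C r" and "x \<in> C"
  shows "(x, x) \<in> r"
  using assms unfolding partial_order_on_def preorder_on_def refl_on_def by auto

text \<open>The free right \<open>S\<close>-poset on one generator: a map out of it is determined by
  the image of the unit. It is the source of the surjection that projectivity splits.\<close>

definition regular_rsposet :: "('s, 'm) pomonoid_scheme \<Rightarrow> ('s, 's) rsposet" where
  "regular_rsposet S = \<lparr>carrier = carrier S, ple = mle S, ract = mult S\<rparr>"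

lemma rsposet_regular: "pomonoid S \<Longrightarrow> rsposet S (regular_rsposet S)"
  unfolding regular_rsposet_def rsposet_def rsposet_axioms_def
  by (auto simp: pomonoid.mle_partial_order pomonoid.mult_mono pomonoid_def
        monoid.m_assoc monoid.m_closed monoid.r_one)

text \<open>\<open>projective\<close> tests only objects with elements of type \<open>'u\<close>.
  When \<open>i\<close> is injective on the carrier, this is an isomorphic copy with elements of
  that type.\<close>

definition transport_rsposet :: "('a \<Rightarrow> 'u) \<Rightarrow> ('a, 's) rsposet \<Rightarrow> ('u, 's) rsposet" where
  "transport_rsposet i A =
     \<lparr>carrier = i ` carrier A, ple = map_prod i i ` ple A,
      ract = (\<lambda>x s. i (ract A (inv_into (carrier A) i x) s))\<rparr>"

lemma partial_order_on_image:
  assumes "partial_order_on C r" and "inj_on i C"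
  shows "partial_order_on (i ` C) (map_prod i i ` r)"
proof -
  note mem = partial_order_on_carrier[OF assms(1)]
  have eq: "x = y" if "i x = i y" "x \<in> C" "y \<in> C" for x y
    using that assms(2) by (auto dest: inj_onD)
  have "trans r" "antisym r" "r \<subseteq> C \<times> C" "refl_on C r"
    using assms(1) mem by (auto simp: partial_order_on_def preorder_on_def)
  have "trans (map_prod i i ` r)"
  proof (rule transI)
    fix x y z
    assume "(x, y) \<in> map_prod i i ` r" "(y, z) \<in> map_prod i i ` r"
    then obtain a b b' c where "(a, b) \<in> r" "(b', c) \<in> r" "x = i a" "y = i b" "i b = i b'" "z = i c"
      by auto
    \<comment> \<open>The two pairs give \<open>y\<close> two preimages in \<open>C\<close>, which
      injectivity identifies; antisymmetry below uses the same argument.\<close>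
    moreover from this have "b = b'" using mem eq by blast
    ultimately have "(a, c) \<in> r" using \<open>trans r\<close> by (auto dest: transD)
    then show "(x, z) \<in> map_prod i i ` r" using \<open>x = i a\<close> \<open>z = i c\<close> by force
  qed
  moreover have "antisym (map_prod i i ` r)"
  proof (rule antisymI)
    fix x y
    assume "(x, y) \<in> map_prod i i ` r" "(y, x) \<in> map_prod i i ` r"
    then obtain a b a' b' where *: "(a, b) \<in> r" "(b', a') \<in> r" "x = i a" "y = i b" "i b = i b'" "i a = i a'"
      by auto
    then have "b = b'" "a = a'" using mem eq by blast+
    then show "x = y" using * \<open>antisym r\<close> by (auto dest: antisymD)
  qed
  ultimately show ?thesis
    using \<open>refl_on C r\<close> \<open>r \<subseteq> C \<times> C\<close>
    unfolding partial_order_on_def preorder_on_def refl_on_def by fastforce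
qed

lemma rsposet_transport:
  assumes "rsposet S A" and inj: "inj_on i (carrier A)"
  shows "rsposet S (transport_rsposet i A)"
proof -
  interpret A: rsposet S A by fact
  note mem = partial_order_on_carrier[OF A.ple_partial_order]
  show ?thesis
  proof unfold_locales
    show "partial_order_on (carrier (transport_rsposet i A)) (ple (transport_rsposet i A))"
      using partial_order_on_image[OF A.ple_partial_order inj] by (simp add: transport_rsposet_def)
  next
    fix x y s t
    assume "(x, y) \<in> ple (transport_rsposet i A)" and st: "(s, t) \<in> mle S"
    then obtain a b where ab: "(a, b) \<in> ple A" "x = i a" "y = i b"
      by (auto simp: transport_rsposet_def)
    then show "(ract (transport_rsposet i A) x s, ract (transport_rsposet i A) y t)
        \<in> ple (transport_rsposet i A)"
      using A.ract_mono[OF ab(1) st] mem[OF ab(1)] inj by (force simp: transport_rsposet_def)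
  qed (auto simp: transport_rsposet_def inj A.ract_closed A.ract_one A.ract_mult)
qed

lemma rhom_mono: "f \<in> rhom S A B \<Longrightarrow> (x, y) \<in> ple A \<Longrightarrow> (f x, f y) \<in> ple B"
  and rhom_closed: "f \<in> rhom S A B \<Longrightarrow> x \<in> carrier A \<Longrightarrow> f x \<in> carrier B"
  and rhom_ract: "f \<in> rhom S A B \<Longrightarrow> x \<in> carrier A \<Longrightarrow> s \<in> carrier S \<Longrightarrow>
    f (ract A x s) = ract B (f x) s"
  by (auto simp: rhom_def)

text \<open>This map and that of the next lemma are the mutually inverse isomorphisms between
  \<open>A\<close> and its copy. Restriction makes them extensional, as \<open>rhom\<close>
  demands.\<close>

lemma inv_into_rhom:
  assumes "rsposet S A" and inj: "inj_on i (carrier A)"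
  shows "restrict (inv_into (carrier A) i) (i ` carrier A) \<in> rhom S (transport_rsposet i A) A"
proof -
  interpret A: rsposet S A by fact
  note mem = partial_order_on_carrier[OF A.ple_partial_order]
  show ?thesis
    using inj mem by (auto simp: rhom_def transport_rsposet_def A.ract_closed)
qed

lemma restrict_rhom_transport:
  assumes "rsposet S A" and inj: "inj_on i (carrier A)"
  shows "restrict i (carrier A) \<in> rhom S A (transport_rsposet i A)"
proof -
  interpret A: rsposet S A by fact
  note mem = partial_order_on_carrier[OF A.ple_partial_order]
  show ?thesis
    using inj mem by (force simp: rhom_def transport_rsposet_def A.ract_closed)
qed

lemma compose_rhom:
  assumes "rsposet S A" and "f \<in> rhom S A B" and "g \<in> rhom S B C"
  shows "compose (carrier A) g f \<in> rhom S A C"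
proof -
  interpret A: rsposet S A by fact
  note mem = partial_order_on_carrier[OF A.ple_partial_order]
  show ?thesis
    using assms(2,3) mem by (auto simp: rhom_def compose_def A.ract_closed PiE_mem)
qed

text \<open>Frees the lifting property from the type \<open>'u\<close>: \<open>X\<close> and
  \<open>Y\<close> are replaced by copies inside \<open>'u\<close>, the lift is taken there and
  carried back. \<open>P\<close> needs no copy, since its type is already unconstrained.\<close>

lemma projective_lift:
  fixes X :: "('a, 's) rsposet" and Y :: "('b, 's) rsposet" and P :: "('p, 's) rsposet"
  assumes P: "projective TYPE('u) S P"
    and X: "rsposet S X" and Y: "rsposet S Y"
    and smallX: "carrier X \<lesssim> (UNIV :: 'u set)" and smallY: "carrier Y \<lesssim> (UNIV :: 'u set)"
    and q: "q \<in> rhom S X Y" "q ` carrier X = carrier Y" and g: "g \<in> rhom S P Y"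
  obtains g' where "g' \<in> rhom S P X" and "compose (carrier P) q g' = g"
proof -
  obtain i :: "'a \<Rightarrow> 'u" where i: "inj_on i (carrier X)" using smallX by (auto simp: lepoll_def)
  obtain j :: "'b \<Rightarrow> 'u" where j: "inj_on j (carrier Y)" using smallY by (auto simp: lepoll_def)
  let ?X = "transport_rsposet i X" and ?Y = "transport_rsposet j Y"
  let ?r = "restrict (inv_into (carrier X) i) (i ` carrier X)"
  let ?j = "restrict j (carrier Y)"
  have carr: "carrier ?X = i ` carrier X" "carrier ?Y = j ` carrier Y"
    by (auto simp: transport_rsposet_def)
  note rX = rsposet_transport[OF X i] and rY = rsposet_transport[OF Y j]
  note r = inv_into_rhom[OF X i] and jh = restrict_rhom_transport[OF Y j]
  have rP: "rsposet S P" using P by (simp add: projective_def)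
  \<comment> \<open>\<open>q\<close> conjugated by the two isomorphisms: back to \<open>X\<close>,
    along \<open>q\<close>, then into the copy of \<open>Y\<close>.\<close>
  let ?q = "compose (carrier ?X) ?j (compose (carrier ?X) q ?r)"
  let ?g = "compose (carrier P) ?j g"
  have hq: "?q \<in> rhom S ?X ?Y" by (rule compose_rhom[OF rX compose_rhom[OF rX r q(1)] jh])
  have hg: "?g \<in> rhom S P ?Y" by (rule compose_rhom[OF rP g jh])
  have q_i: "?q (i x) = j (q x)" if "x \<in> carrier X" for x
    using that i rhom_closed[OF q(1)] by (auto simp: compose_def carr)
  have "?q ` carrier ?X = (\<lambda>x. j (q x)) ` carrier X"
    unfolding carr(1) image_image using q_i[unfolded carr(1)] by (intro image_cong refl)
  then have surj: "?q ` carrier ?X = carrier ?Y"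
    unfolding carr(2) q(2)[symmetric] image_image .
  obtain k where k: "k \<in> rhom S P ?X" and kq: "compose (carrier P) ?q k = ?g"
    using P rX rY hq surj hg unfolding projective_def by blast
  show ?thesis
  proof
    show k': "compose (carrier P) ?r k \<in> rhom S P X" by (rule compose_rhom[OF rP k r])
    show "compose (carrier P) q (compose (carrier P) ?r k) = g"
    proof (rule extensionalityI)
      show "g \<in> extensional (carrier P)" using g by (auto simp: rhom_def PiE_def)
      fix p assume p: "p \<in> carrier P"
      then obtain x where x: "x \<in> carrier X" "k p = i x" using rhom_closed[OF k p] by (auto simp: carr)
      \<comment> \<open>The lifting equation holds in the copy of \<open>Y\<close>; injectivity of
        \<open>j\<close> brings it back to \<open>Y\<close>.\<close>
      have "j (q x) = j (g p)"
        using fun_cong[OF kq, of p] p x q_i[OF x(1)] rhom_closed[OF g p] by (simp add: compose_eq)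
      then have "q x = g p"
        using inj_onD[OF j] rhom_closed[OF q(1) x(1)] rhom_closed[OF g p] by blast
      then show "compose (carrier P) q (compose (carrier P) ?r k) p = g p"
        using p x i by (simp add: compose_eq)
    qed simp
  qed
qed

text \<open>For a generator \<open>c\<close>, the map from \<open>S\<close> to \<open>C\<close>
  given by acting on \<open>c\<close> is surjective, so the identity of \<open>C\<close> lifts along
  it; the lift is \<open>g\<close>.\<close>

lemma cyclic_projective_section:
  fixes C :: "('c, 's) rsposet"
  assumes "cyclic S C" and "projective TYPE('u) S C"
    and "carrier S \<lesssim> (UNIV :: 'u set)" and "carrier C \<lesssim> (UNIV :: 'u set)"
  obtains c g where "c \<in> carrier C" and "g \<in> rhom S C (regular_rsposet S)"
    and "\<And>x. x \<in> carrier C \<Longrightarrow> ract C c (g x) = x"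
proof -
  interpret C: rsposet S C using assms(1) by (simp add: cyclic_def)
  note mem = partial_order_on_carrier[OF C.mle_partial_order]
  obtain c where c: "c \<in> carrier C" "carrier C = {ract C c s |s. s \<in> carrier S}"
    using assms(1) by (auto simp: cyclic_def)
  let ?q = "\<lambda>s \<in> carrier S. ract C c s"
  have q: "?q \<in> rhom S (regular_rsposet S) C"
    using c(1) mem C.ract_mono partial_order_on_refl[OF C.ple_partial_order c(1)]
    by (auto simp: rhom_def regular_rsposet_def C.ract_closed C.ract_mult)
  have surj: "?q ` carrier (regular_rsposet S) = carrier C"
    using c(2) by (auto simp: regular_rsposet_def)
  have id: "(\<lambda>x \<in> carrier C. x) \<in> rhom S C C"
    using partial_order_on_carrier[OF C.ple_partial_order] by (auto simp: rhom_def C.ract_closed)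
  have small: "carrier (regular_rsposet S) \<lesssim> (UNIV :: 'u set)"
    using assms(3) by (simp add: regular_rsposet_def)
  obtain g where g: "g \<in> rhom S C (regular_rsposet S)"
      and eq: "compose (carrier C) ?q g = (\<lambda>x \<in> carrier C. x)"
    using projective_lift[OF assms(2) rsposet_regular[OF C.pomonoid_axioms] C.rsposet_axioms
        small assms(4) q surj id] by blast
  have "ract C c (g x) = x" if "x \<in> carrier C" for x
    using fun_cong[OF eq, of x] that rhom_closed[OF g that]
    by (simp add: compose_eq regular_rsposet_def)
  then show thesis using that c(1) g by blast
qed

text \<open>If \<open>k a = 1\<close>, then \<open>a' \<mapsto> k(a') x\<close> sends \<open>a\<close> to a prescribed element \<open>x\<close>.\<close>

lemma generator_if_map_to_monoid:
  fixes G :: "('a, 't) ltposet"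
  assumes "ltposet T G"
    and k_closed: "\<And>a. a \<in> carrier G \<Longrightarrow> k a \<in> carrier T"
    and k_mono: "\<And>a b. (a, b) \<in> ple G \<Longrightarrow> (k a, k b) \<in> mle T"
    and k_lact: "\<And>t a. t \<in> carrier T \<Longrightarrow> a \<in> carrier G \<Longrightarrow> k (lact G t a) = t \<otimes>\<^bsub>T\<^esub> k a"
    and k_one: "a\<^sub>0 \<in> carrier G" "k a\<^sub>0 = \<one>\<^bsub>T\<^esub>"
  shows "generator TYPE('x) T G"
  unfolding generator_def
proof (intro conjI allI impI)
  fix X Y :: "('x, 't) ltposet" and \<alpha> \<beta>
  assume "ltposet T X \<and> ltposet T Y \<and> \<alpha> \<in> lhom T X Y \<and> \<beta> \<in> lhom T X Y \<and> \<alpha> \<noteq> \<beta>"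
  then have "ltposet T X" and \<alpha>: "\<alpha> \<in> lhom T X Y" and \<beta>: "\<beta> \<in> lhom T X Y" and "\<alpha> \<noteq> \<beta>" by auto
  interpret G: ltposet T G by fact
  interpret X: ltposet T X by fact
  note mem = partial_order_on_carrier[OF G.ple_partial_order]
  \<comment> \<open>Morphisms are extensional, so distinct ones already differ at a point of the
    carrier.\<close>
  obtain x where x: "x \<in> carrier X" "\<alpha> x \<noteq> \<beta> x"
    using PiE_ext[of \<alpha> "carrier X" "\<lambda>_. carrier Y" \<beta>] \<alpha> \<beta> \<open>\<alpha> \<noteq> \<beta>\<close> unfolding lhom_def by blast
  let ?g = "\<lambda>a \<in> carrier G. lact X (k a) x"
  have "?g \<in> lhom T G X"
    using x(1) mem k_mono partial_order_on_refl[OF X.ple_partial_order x(1)]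
    by (auto simp: lhom_def k_closed k_lact X.lact_closed G.lact_closed X.lact_mult X.lact_mono)
  moreover have "compose (carrier G) \<alpha> ?g a\<^sub>0 \<noteq> compose (carrier G) \<beta> ?g a\<^sub>0"
    using x k_one by (simp add: compose_eq X.lact_one)
  ultimately show "\<exists>g \<in> lhom T G X. compose (carrier G) \<alpha> g \<noteq> compose (carrier G) \<beta> g"
    by metis
qed fact

theorem proposition3p14:
  fixes S :: "'s pomonoid" and T :: "'t pomonoid"
    and A :: "('a, 's, 't) biposet" and B :: "('b, 's) rsposet" and f :: "'a \<Rightarrow> 'b"
  assumes "pomonoid S" and "pomonoid T"
    and "rsposet S B" and "biposet T S A"
    (* the universe 'u of the category Pos-S is large enough to contain S and A x B;
       the universe 'x of T-Pos is arbitrary *)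
    and "carrier S \<lesssim> (UNIV :: 'u set)"
    and "carrier (prod_rsposet (right_part A) B) \<lesssim> (UNIV :: 'u set)"
    and "cyclic S (prod_rsposet (right_part A) B)"
    and "projective TYPE('u) S (prod_rsposet (right_part A) B)"
    and "emb_injective TYPE('u) S (right_part A) B f"
    and "(\<lambda>t. \<lambda>a \<in> carrier A. blact A t a) \<in> pomonoid_iso T (End_pomonoid S (right_part A))"
  shows "generator TYPE('x) T (left_part A)"
proof -
  let ?R = "right_part A" and ?C = "prod_rsposet (right_part A) B"
  let ?E = "End_pomonoid S (right_part A)"
  let ?l = "\<lambda>t. \<lambda>a \<in> carrier A. blact A t a"
  interpret A: biposet T S A by fact
  have R: "carrier ?R = carrier A" "ple ?R = ple A" "ract ?R = bract A"
    and L: "carrier (left_part A) = carrier A" "ple (left_part A) = ple A" "lact (left_part A) = blact A"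
    by (auto simp: right_part_def left_part_def)
  note memA = partial_order_on_carrier[OF A.right.ple_partial_order, unfolded R]
  note memS = partial_order_on_carrier[OF A.right.mle_partial_order]
  have f: "f \<in> rhom S ?R B" using assms(9) by (simp add: emb_injective_def)
  note f_closed = rhom_closed[OF f, unfolded R] and f_mono = rhom_mono[OF f, unfolded R]
    and f_ract = rhom_ract[OF f, unfolded R]
  obtain c g where c: "c \<in> carrier ?C" and g: "g \<in> rhom S ?C (regular_rsposet S)"
    and cg: "\<And>x. x \<in> carrier ?C \<Longrightarrow> ract ?C c (g x) = x"
    using cyclic_projective_section[OF assms(7,8,5,6)] by blast
  obtain a\<^sub>0 b\<^sub>0 where ab: "c = (a\<^sub>0, b\<^sub>0)" by (cases c)
  have a\<^sub>0: "a\<^sub>0 \<in> carrier A" using c ab by (simp add: prod_rsposet_def R)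
  \<comment> \<open>The graph map of \<open>f\<close> goes from \<open>A\<close> into the product
    and respects order and action because \<open>f\<close> does. Following it by \<open>g\<close>
    gives an \<open>S\<close>-poset map from \<open>A\<close> to \<open>S\<close>.\<close>
  define h where "h x = g (x, f x)" for x
  have h_closed: "h x \<in> carrier S" if "x \<in> carrier A" for x
    using rhom_closed[OF g, of "(x, f x)"] that f_closed
    by (simp add: h_def prod_rsposet_def regular_rsposet_def R)
  have h_mono: "(h x, h y) \<in> mle S" if "(x, y) \<in> ple A" for x y
    using rhom_mono[OF g, of "(x, f x)" "(y, f y)"] that f_mono
    by (simp add: h_def prod_rsposet_def regular_rsposet_def R)
  have h_ract: "h (bract A x s) = h x \<otimes>\<^bsub>S\<^esub> s" if "x \<in> carrier A" "s \<in> carrier S" for x s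
    using rhom_ract[OF g, of "(x, f x)" s] that f_closed f_ract
    by (simp add: h_def prod_rsposet_def regular_rsposet_def R)
  \<comment> \<open>First coordinate of the section equation at the point
    \<open>(x, f x)\<close>.\<close>
  have a\<^sub>0_h: "bract A a\<^sub>0 (h x) = x" if "x \<in> carrier A" for x
    using cg[of "(x, f x)"] that f_closed by (simp add: h_def prod_rsposet_def R ab)

  \<comment> \<open>The curried map: \<open>h\<close> followed by the action on \<open>a\<close>. It
    commutes with \<open>T\<close> in \<open>a\<close> because the two actions on \<open>A\<close>
    commute.\<close>
  define \<kappa> where "\<kappa> a = (\<lambda>x \<in> carrier A. bract A a (h x))" for a
  have \<kappa>_closed: "\<kappa> a \<in> carrier ?E" if "a \<in> carrier A" for a
    using that memA h_closed h_mono h_ract A.right.ract_closed A.right.ract_mult A.right.ract_mono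
      partial_order_on_refl[OF A.right.ple_partial_order]
    by (auto simp: \<kappa>_def End_pomonoid_def rhom_def R)
  have \<kappa>_mono: "(\<kappa> a, \<kappa> b) \<in> mle ?E" if "(a, b) \<in> ple A" for a b
    using that memA[OF that] \<kappa>_closed h_closed A.right.ract_mono
      partial_order_on_refl[OF A.right.mle_partial_order]
    by (auto simp: End_pomonoid_def R \<kappa>_def)
  have \<kappa>_lact: "\<kappa> (blact A t a) = ?l t \<otimes>\<^bsub>?E\<^esub> \<kappa> a" if "t \<in> carrier T" "a \<in> carrier A" for t a
    using that h_closed A.actions_commute A.right.ract_closed
    by (auto simp: \<kappa>_def End_pomonoid_def R compose_def fun_eq_iff)
  have \<kappa>_one: "\<kappa> a\<^sub>0 = \<one>\<^bsub>?E\<^esub>"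
    using a\<^sub>0_h by (auto simp: \<kappa>_def End_pomonoid_def R fun_eq_iff)

  have bij: "bij_betw ?l (carrier T) (carrier ?E)"
    and lam_mult: "\<And>s t. s \<in> carrier T \<Longrightarrow> t \<in> carrier T \<Longrightarrow> ?l (s \<otimes>\<^bsub>T\<^esub> t) = ?l s \<otimes>\<^bsub>?E\<^esub> ?l t"
    and lam_one: "?l \<one>\<^bsub>T\<^esub> = \<one>\<^bsub>?E\<^esub>"
    and lam_ord: "\<And>s t. s \<in> carrier T \<Longrightarrow> t \<in> carrier T \<Longrightarrow> (s, t) \<in> mle T \<longleftrightarrow> (?l s, ?l t) \<in> mle ?E"
    using assms(10) unfolding pomonoid_iso_def iso_def hom_def by blast+
  \<comment> \<open>\<open>\<kappa>\<close> takes values in the endomorphisms; the inverse of the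
    isomorphism turns it into a map to \<open>T\<close>.\<close>
  define k where "k a = inv_into (carrier T) ?l (\<kappa> a)" for a
  have k_closed: "k a \<in> carrier T" and lam_k: "?l (k a) = \<kappa> a" if "a \<in> carrier A" for a
    using \<kappa>_closed[OF that] bij inv_into_into[of "\<kappa> a" ?l "carrier T"]
      f_inv_into_f[of "\<kappa> a" ?l "carrier T"]
    unfolding k_def bij_betw_def by auto
  have lam_inj: "s = t" if "?l s = ?l t" "s \<in> carrier T" "t \<in> carrier T" for s t
    using inj_onD[OF bij_betw_imp_inj_on[OF bij] that] .
  show ?thesis
  proof (rule generator_if_map_to_monoid[where k = k and a\<^sub>0 = a\<^sub>0], unfold L)
    show "ltposet T (left_part A)" by (rule A.left.ltposet_axioms)
    show "k a \<in> carrier T" if "a \<in> carrier A" for a by (rule k_closed[OF that])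
    \<comment> \<open>This is where the isomorphism must reflect the order: the inequality is known
      between \<open>\<kappa> a\<close> and \<open>\<kappa> b\<close>.\<close>
    show "(k a, k b) \<in> mle T" if "(a, b) \<in> ple A" for a b
      using lam_ord[OF k_closed k_closed] lam_k \<kappa>_mono[OF that] memA[OF that] by simp
    \<comment> \<open>Both sides have the same image among the endomorphisms, by
      \<open>\<kappa>_lact\<close> and multiplicativity.\<close>
    show "k (blact A t a) = t \<otimes>\<^bsub>T\<^esub> k a" if "t \<in> carrier T" "a \<in> carrier A" for t a
    proof (rule lam_inj)
      have ta: "blact A t a \<in> carrier A" using A.left.lact_closed[unfolded L] that by blast
      show "?l (k (blact A t a)) = ?l (t \<otimes>\<^bsub>T\<^esub> k a)"
        using lam_k[OF ta] lam_mult[OF that(1) k_closed] \<kappa>_lact[OF that] lam_k[OF that(2)] that by simp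
      show "k (blact A t a) \<in> carrier T" by (rule k_closed[OF ta])
      show "t \<otimes>\<^bsub>T\<^esub> k a \<in> carrier T" using that k_closed by simp
    qed
    show "a\<^sub>0 \<in> carrier A" by fact
    show "k a\<^sub>0 = \<one>\<^bsub>T\<^esub>"
      using lam_inj[OF _ k_closed[OF a\<^sub>0] A.left.one_closed] lam_k[OF a\<^sub>0] \<kappa>_one lam_one by simp
  qed
qed

end
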